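(* Let $d \ge 11$ be an integer. There exists no balanced sequence $\mathbf{v}$ over an alphabet of $d$ letters whose critical exponent satisfies $\mathrm{E}(\mathbf{v}) < \frac{d-1}{d-2}$.
   Context: A sequence $\mathbf{v}$ over a finite alphabet $\mathcal A$ is balanced if for every letter $a\in\mathcal A$ and every two factors $u,v$ of $\mathbf{v}$ with $|u|=|v|$ we have $|u|_a-|v|_a\le 1$ (where $|u|_a$ is the number of occurrences of $a$ in $u$). For a nonempty finite word $z$, let $u$ be the shortest word such that $z$ is a prefix of $uuu\cdots$; the exponent of $z$ is $\exp(z)=|z|/|u|$. The critical exponent of a sequence $\mathbf{v}$ is $\mathrm{E}(\mathbf{v})=\sup\{\exp(z): z \text{ a nonempty factor of } \mathbf{v}\}$. *)

theory Defs
  imports Complex_Main "HOL-Library.Omega_Words_Fun" "HOL-Library.Extended_Real"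
begin

definition factors :: "'a word \<Rightarrow> 'a list set" where
  "factors v = {v [i \<rightarrow> j] | i j. i \<le> j}"

definition balanced :: "'a set \<Rightarrow> 'a word \<Rightarrow> bool" where
  "balanced A v \<longleftrightarrow>
     (\<forall>a\<in>A. \<forall>x\<in>factors v. \<forall>y\<in>factors v. length x = length y \<longrightarrow>
        int (count_list x a) - int (count_list y a) \<le> 1)"

(* The nonemptiness of u is needed because the omega-power of the empty word is undefined.
   For z = [] the minimum is not unique, so the root is only meaningful for nonempty z. *)
definition frac_root :: "'a list \<Rightarrow> 'a list" where
  "frac_root z = (ARG_MIN length u. u \<noteq> [] \<and> z = prefix (length z) (u\<^sup>\<omega>))"

definition exponent :: "'a list \<Rightarrow> real" where
  "exponent z = real (length z) / real (length (frac_root z))"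

(* Taken in the extended reals, since the supremum is infinite e.g. for periodic sequences. *)
definition critical_exponent :: "'a word \<Rightarrow> ereal" where
  "critical_exponent v = (SUP z \<in> factors v - {[]}. ereal (exponent z))"

end

(* If the critical exponent is below (d-1)/(d-2), then any d-1 consecutive letters are distinct, so
   every letter returns after d-1, d or d+1 steps (a short, medium or long gap). No factor of length 2
   repeats at such a distance, so consecutive positions have different gaps, and a long gap sits
   exactly in front of each short one. Balancedness forbids that a letter has both a short and a
   long gap. Hence the medium gaps behave like defects in a traffic cellular automaton: each drifts forever by d+1 or forever by
   d-1. Two defects drifting in different directions would collide, so all drift the same way and
   the sequence of gaps is eventually periodic. Then v is eventually periodic as well, and its
   critical exponent is infinite. *)

theory Submission
  imports Defs
begin

section \<open>Repetitions and the critical exponent\<close>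

lemma subsequence_in_factors: "i \<le> j \<Longrightarrow> v [i \<rightarrow> j] \<in> factors v"
  unfolding factors_def by blast

text \<open>The factor of length \<open>p + q\<close> at \<open>i\<close> is a prefix of the
  infinite power of its first \<open>p\<close> letters, so its root has length at most
  \<open>p\<close>. This turns a bound on exponents into one on equalities between letters.\<close>

lemma critical_exponent_ge_repetition:
  assumes "p > 0" and rep: "\<And>k. k < q \<Longrightarrow> v (i + p + k) = v (i + k)"
  shows "ereal (real (p + q) / real p) \<le> critical_exponent v"
proof -
  define z where "z = v [i \<rightarrow> i + p + q]"
  define u where "u = v [i \<rightarrow> i + p]"
  have len: "length z = p + q" "length u = p"
    by (simp_all add: z_def u_def)
  have per: "v (i + k) = v (i + k mod p)" if "k < p + q" for k
    using that
  proof (induction k rule: less_induct)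
    case (less k)
    show ?case
    proof (cases "k < p")
      case False
      then have "v (i + k) = v (i + (k - p))"
        using rep[of "k - p"] less.prems by simp
      also have "\<dots> = v (i + (k - p) mod p)"
        using less.IH[of "k - p"] less.prems False \<open>p > 0\<close> by simp
      finally show ?thesis
        using False by (simp add: le_mod_geq)
    qed simp
  qed
  have "u \<noteq> []"
    using \<open>p > 0\<close> len by auto
  have "z = prefix (length z) (u\<^sup>\<omega>)"
  proof (rule nth_equalityI)
    fix k assume "k < length z"
    then have k: "k < p + q" by (simp add: len)
    have "z ! k = v (i + k)"
      using k by (simp add: z_def)
    also have "\<dots> = u ! (k mod p)"
      using per[OF k] \<open>p > 0\<close> by (simp add: u_def)
    also have "\<dots> = prefix (length z) (u\<^sup>\<omega>) ! k"
      using k \<open>u \<noteq> []\<close> by (simp add: len iter_def)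
    finally show "z ! k = prefix (length z) (u\<^sup>\<omega>) ! k" .
  qed simp
  then have root: "frac_root z \<noteq> []" "length (frac_root z) \<le> p"
    using \<open>u \<noteq> []\<close> arg_min_nat_lemma[of "\<lambda>u. u \<noteq> [] \<and> z = prefix (length z) (u\<^sup>\<omega>)" u length]
    by (auto simp: frac_root_def len)
  have "real (p + q) / real p \<le> exponent z"
    unfolding exponent_def len using root \<open>p > 0\<close> by (intro divide_left_mono) auto
  moreover have "z \<in> factors v - {[]}"
    using len \<open>p > 0\<close> subsequence_in_factors[of i "i + p + q" v] by (auto simp: z_def)
  ultimately show ?thesis
    unfolding critical_exponent_def by (meson SUP_upper2 ereal_less_eq(3))
qed

text \<open>Here \<open>e\<close> is \<open>d - 1\<close>, which avoids truncated subtraction in the positions below.\<close>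

locale balanced_low_repetition =
  fixes A :: "'a set" and v :: "'a word" and e :: nat
  assumes card_A: "card A = Suc e" and e_ge: "e \<ge> 4"
    and range_v: "range v \<subseteq> A" and bal: "balanced A v"
    and low_rep: "p > 0 \<Longrightarrow> (\<And>k. k < q \<Longrightarrow> v (i + p + k) = v (i + k)) \<Longrightarrow> q * (e - 1) < p"
begin

section \<open>Short repetitions and the possible gaps\<close>

lemma no_pair_repetition:
  assumes "0 < p" "p \<le> e + 2" "v (i + p) = v i" "v (Suc i + p) = v (Suc i)"
  shows False
proof -
  \<comment> \<open>The pair is a repetition with \<open>q = 2\<close>; since
    \<open>e \<ge> 4\<close>, the bound \<open>2 * (e - 1)\<close> is at least
    \<open>e + 2\<close>.\<close>
  have "2 * (e - 1) < p"
  proof (rule low_rep[where i = i])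
    fix k :: nat assume "k < 2"
    then have "k = 0 \<or> k = 1" by auto
    then show "v (i + p + k) = v (i + k)" using assms(3,4) by auto
  qed (use assms in simp)
  then show False using assms(2) e_ge by simp
qed

lemma close_distinct:
  assumes "i < j" "j < i + e"
  shows "v i \<noteq> v j"
proof
  assume "v i = v j"
  then have "1 * (e - 1) < j - i"
    using assms by (intro low_rep[where i = i]) auto
  then show False using assms by simp
qed

definition short where "short n \<longleftrightarrow> v (n + e) = v n"
definition medium where "medium n \<longleftrightarrow> v (n + e + 1) = v n"
definition long where "long n \<longleftrightarrow> v (n + e + 2) = v n"

text \<open>Unless the gap at \<open>n\<close> is short, the \<open>e + 1\<close> letters at
  \<open>n..n + e\<close> are distinct and exhaust \<open>A\<close>. Each later letter occurs among
  them, and \<open>close_distinct\<close> leaves only the earliest positions as candidates.\<close>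

lemma gap_cases: "short n \<or> medium n \<or> long n"
proof (cases "v (n + e) = v n")
  case False
  have "inj_on v {n..n + e}"
  proof (rule linorder_inj_onI')
    fix i j assume "i \<in> {n..n + e}" "j \<in> {n..n + e}" "i < j"
    then show "v i \<noteq> v j"
      using close_distinct[of i j] False by (cases "i = n \<and> j = n + e") auto
  qed
  then have "card (v ` {n..n + e}) = card A"
    by (simp add: card_image card_A)
  moreover have "finite A" using card_A card.infinite by fastforce
  ultimately have "v ` {n..n + e} = A"
    using range_v by (intro card_subset_eq) auto
  then have "v m \<in> v ` {n..n + e}" for m
    using range_v by auto
  then have hit: "\<exists>j. n \<le> j \<and> j \<le> n + e \<and> v m = v j" for m
    by (simp add: image_iff Bex_def)
  show ?thesis
  proof (cases "medium n")
    case nm: False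
    obtain j where "n \<le> j" "j \<le> n + e" "v (n + e + 1) = v j"
      using hit by blast
    then have 1: "v (n + e + 1) = v (n + 1)"
      using close_distinct[of j "n + e + 1"] nm
      by (cases "j = n \<or> j = n + 1") (auto simp: medium_def)
    obtain j where j: "n \<le> j" "j \<le> n + e" "v (n + e + 2) = v j"
      using hit by blast
    \<comment> \<open>Otherwise the pair at \<open>n + 1\<close> would return after \<open>e\<close>
      steps.\<close>
    have "j \<noteq> n + 2"
    proof
      assume "j = n + 2"
      with 1 j show False
        using no_pair_repetition[of e "n + 1"] e_ge by (simp add: ac_simps)
    qed
    moreover have "j \<noteq> n + 1"
      using close_distinct[of "n + e + 1" "n + e + 2"] 1 j e_ge by auto
    ultimately have "j = n"
      using close_distinct[of j "n + e + 2"] j by (cases "j > n + 2") auto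
    then show ?thesis using j by (simp add: long_def)
  qed simp
qed (simp add: short_def)

lemma gap_unique:
  "\<not> (short n \<and> medium n)" "\<not> (short n \<and> long n)" "\<not> (medium n \<and> long n)"
  using close_distinct[of "n + e" "n + e + 1"] close_distinct[of "n + e" "n + e + 2"]
    close_distinct[of "n + e + 1" "n + e + 2"] e_ge
  by (auto simp: short_def medium_def long_def)

lemma consecutive_gaps_differ:
  "\<not> (short n \<and> short (Suc n))" "\<not> (medium n \<and> medium (Suc n))" "\<not> (long n \<and> long (Suc n))"
  using no_pair_repetition[of e n] no_pair_repetition[of "e + 1" n] no_pair_repetition[of "e + 2" n] e_ge
  by (auto simp: short_def medium_def long_def)

text \<open>Both gaps would end at \<open>n + e + 1\<close>, so two adjacent letters would be equal.
  The next exclusion has the same cause, at \<open>n + e + 2\<close>.\<close>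

lemma not_medium_short: "\<not> (medium n \<and> short (Suc n))"
  using close_distinct[of n "Suc n"] e_ge by (auto simp: short_def medium_def)

lemma not_long_medium: "\<not> (long n \<and> medium (Suc n))"
  using close_distinct[of n "Suc n"] e_ge by (auto simp: long_def medium_def)

lemma long_iff_short_Suc: "long n \<longleftrightarrow> short (Suc n)"
  using gap_cases[of n] gap_cases[of "Suc n"] consecutive_gaps_differ[of n]
    not_medium_short[of n] not_long_medium[of n] by blast

text \<open>A window of length \<open>e + 1\<close> starting at the short gap contains the letter
  twice, while the \<open>e + 1\<close> positions strictly inside the long gap do not contain it.
  Balancedness forbids a difference of 2.\<close>

lemma not_short_and_long:
  assumes "v m = v n" "short n" "long m"
  shows False
proof -
  define a where "a = v n"
  define x where "x = v [n \<rightarrow> n + e + 1]"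
  define y where "y = v [m + 1 \<rightarrow> m + e + 2]"
  have "x = a # (v [n + 1 \<rightarrow> n + e]) @ [a]"
    using assms(2) e_ge by (simp add: x_def a_def short_def subsequence_def upt_conv_Cons)
  then have "count_list x a \<ge> 2" by simp
  moreover have "a \<notin> set y"
  proof
    assume "a \<in> set y"
    then obtain j where j: "m + 1 \<le> j" "j < m + e + 2" "v j = a"
      by (auto simp: y_def subsequence_def simp del: upt_Suc)
    have "v m = a" "v (m + e + 2) = a"
      using assms by (simp_all add: a_def long_def)
    then show False
      using close_distinct[of m j] close_distinct[of j "m + e + 2"] j e_ge
      by (cases "j < m + e") auto
  qed
  moreover have "x \<in> factors v" "y \<in> factors v"
    unfolding x_def y_def by (intro subsequence_in_factors; simp)+
  moreover have "length x = length y" by (simp add: x_def y_def)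
  moreover have "a \<in> A" using range_v by (auto simp: a_def)
  ultimately show False
    using bal unfolding balanced_def by (force simp: count_list_0_iff)
qed

lemma not_long_after_short: "short n \<Longrightarrow> \<not> long (n + e)"
  using not_short_and_long[of "n + e" n] by (auto simp: short_def)

lemma not_short_after_long: "long n \<Longrightarrow> \<not> short (n + e + 2)"
  using not_short_and_long[of n "n + e + 2"] by (auto simp: long_def)

section \<open>Drift of the medium gaps\<close>

lemma around_medium:
  assumes "medium n" "n \<ge> 2"
  shows "short (n - 1)" "long (n - 2)" "long (n + 1)" "short (n + 2)"
proof -
  obtain k where n: "n = Suc (Suc k)"
    using assms(2) by (metis One_nat_def Suc_1 Suc_le_D Suc_le_mono)
  \<comment> \<open>The exclusions for adjacent gaps leave one type on either side;
    \<open>long_iff_short_Suc\<close> then gives the outer neighbours.\<close>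
  show "short (n - 1)"
    using assms(1) gap_cases[of "Suc k"] consecutive_gaps_differ[of "Suc k"] not_long_medium[of "Suc k"]
    by (auto simp: n)
  then show "long (n - 2)" by (simp add: n long_iff_short_Suc)
  show "long (n + 1)"
    using assms(1) gap_cases[of "Suc n"] consecutive_gaps_differ[of n] not_medium_short[of n] by auto
  then show "short (n + 2)" by (simp add: long_iff_short_Suc)
qed

text \<open>The letter at position \<open>n\<close> with a medium gap next occurs at \<open>n + e + 1\<close>. Its gap there is
  short or long, and it decides whether the medium gaps drift to the right or to the left.\<close>

lemma medium_drift:
  assumes "medium n" "n \<ge> 2"
  shows "short (n + e + 1) \<and> medium (n + e + 2) \<or> long (n + e + 1) \<and> medium (n + e)"
proof -
  obtain k where n: "n = k + 2" using assms(2) by (metis add.commute le_Suc_ex)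
  note nb = around_medium[OF assms]
  \<comment> \<open>The letters of the long gap at \<open>n - 2\<close> and of the short gap at
    \<open>n + 2\<close> return at \<open>n + e\<close> and \<open>n + e + 2\<close>, where
    balancedness excludes the opposite extreme.\<close>
  have "\<not> short (n + e)"
    using not_short_after_long[OF nb(2)] by (simp add: n algebra_simps)
  moreover have "\<not> long (n + e + 2)"
    using not_long_after_short[OF nb(4)] by (simp add: algebra_simps)
  ultimately show ?thesis
    using gap_cases[of "n + e"] gap_cases[of "n + e + 1"] gap_cases[of "n + e + 2"]
      consecutive_gaps_differ[of "n + e"] consecutive_gaps_differ[of "n + e + 1"]
      not_long_medium[of "n + e"]
    by auto
qed

text \<open>The direction persists: the letter that decides the next step is
  \<open>v (n + 2)\<close>, which has a short gap at \<open>n + 2\<close> and so never a long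
  one.\<close>

lemma right_drift:
  assumes "medium n" "short (n + e + 1)" "n \<ge> 2"
  shows "medium (n + e + 2) \<and> short (n + e + 2 + e + 1)"
proof -
  have m: "medium (n + e + 2)"
    using medium_drift[OF assms(1,3)] assms(2) gap_unique by blast
  have "v (n + e + 2 + e + 1) = v (n + 2)"
    using m around_medium(4)[OF assms(1,3)] by (simp add: medium_def short_def algebra_simps)
  then have "\<not> long (n + e + 2 + e + 1)"
    using not_short_and_long around_medium(4)[OF assms(1,3)] by blast
  then show ?thesis using medium_drift[OF m] m by simp
qed

text \<open>Mirror image: the deciding letter is now \<open>v (n - 2)\<close>, which has a long
  gap.\<close>

lemma left_drift:
  assumes "medium n" "long (n + e + 1)" "n \<ge> 2"
  shows "medium (n + e) \<and> long (n + e + e + 1)"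
proof -
  have m: "medium (n + e)"
    using medium_drift[OF assms(1,3)] assms(2) gap_unique by blast
  obtain k where n: "n = k + 2" using assms(3) by (metis add.commute le_Suc_ex)
  have k: "long k" using around_medium(2)[OF assms(1,3)] by (simp add: n)
  have "v (n + e + e + 1) = v k"
    using m k by (simp add: medium_def long_def n algebra_simps)
  then have "\<not> short (n + e + e + 1)"
    using not_short_and_long k by metis
  then show ?thesis using medium_drift[OF m] m assms(3) by simp
qed

lemma right_drift_iterate:
  assumes "medium n" "short (n + e + 1)" "n \<ge> 2"
  shows "medium (n + k * (e + 2)) \<and> short (n + k * (e + 2) + e + 1)"
proof (induction k)
  case (Suc k)
  then show ?case
    using right_drift[of "n + k * (e + 2)"] assms(3) by (simp add: algebra_simps)
qed (use assms in simp)

lemma left_drift_iterate: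
  assumes "medium n" "long (n + e + 1)" "n \<ge> 2"
  shows "medium (n + k * e) \<and> long (n + k * e + e + 1)"
proof (induction k)
  case (Suc k)
  then show ?case
    using left_drift[of "n + k * e"] assms(3) by (simp add: algebra_simps)
qed (use assms in simp)

text \<open>A right-drifting and a left-drifting medium gap would eventually meet.\<close>

lemma not_both_drifts:
  assumes "medium m" "short (m + e + 1)" "m \<ge> 2" "medium n" "long (n + e + 1)" "n \<ge> 2"
  shows False
proof -
  \<comment> \<open>After \<open>m\<close> rounds the left-drifting gap is at
    \<open>m * e + n\<close>, which lies \<open>w\<close> positions to the right of
    \<open>m\<close>. Each further common round shortens the distance by 2, so
    \<open>w div 2\<close> rounds leave 0 or 1.\<close>
  define w where "w = m * e + n - m"
  have w: "m + w = m * e + n" using e_ge by (simp add: w_def trans_le_add1)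
  define k where "k = w div 2"
  define a where "a = m + k * (e + 2)"
  define b where "b = n + (m + k) * e"
  have a: "medium a" "short (a + e + 1)"
    using right_drift_iterate[OF assms(1-3), of k] by (simp_all add: a_def)
  have b: "medium b" "long (b + e + 1)"
    using left_drift_iterate[OF assms(4-6), of "m + k"] by (simp_all add: b_def)
  have "w = 2 * k \<or> w = 2 * k + 1" by (auto simp: k_def)
  then have "b = a \<or> b = a + 1"
    using w by (auto simp: a_def b_def algebra_simps)
  \<comment> \<open>Distance 0 makes one gap both short and long; distance 1 makes two adjacent gaps
    medium.\<close>
  then show False
    using a b gap_unique consecutive_gaps_differ(2)[of a] by auto
qed

section \<open>Periodicity of the gaps and of the sequence\<close>

lemma gaps_periodic:
  obtains D where "D > 0" "\<And>n. n \<ge> 3 \<Longrightarrow>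
    (short (n + D) \<longleftrightarrow> short n) \<and> (medium (n + D) \<longleftrightarrow> medium n) \<and> (long (n + D) \<longleftrightarrow> long n)"
proof (cases "\<exists>n\<ge>2. medium n \<and> long (n + e + 1)")
  case False
  then have right: "short (n + e + 1) \<and> medium (n + e + 2)" if "medium n" "n \<ge> 2" for n
    using medium_drift[OF that] that by blast
  have L: "long (n + e + 2)" if "long n" for n
  proof (rule ccontr)
    assume "\<not> long (n + e + 2)"
    then have m: "medium (n + e + 2)"
      using gap_cases not_short_after_long[OF that] by blast
    \<comment> \<open>By \<open>right\<close> this occurrence has a short gap, although the same
      letter has a long gap at \<open>n\<close>.\<close>
    then have "v (n + e + 2 + e + 1) = v n"
      using that by (simp add: medium_def long_def)
    then show False
      using right[OF m] not_short_and_long that by (metis le_add2)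
  qed
  have S: "short (n + e + 2)" if "short n" "n \<ge> 3" for n
    using L[of "n - 1"] that long_iff_short_Suc[of "n - 1"] long_iff_short_Suc[of "n - 1 + e + 2"] by simp
  \<comment> \<open>Exactly one type holds at each position, so preservation of all three types
    already gives the equivalences.\<close>
  have "(short (n + (e + 2)) \<longleftrightarrow> short n) \<and> (medium (n + (e + 2)) \<longleftrightarrow> medium n) \<and>
      (long (n + (e + 2)) \<longleftrightarrow> long n)" if "n \<ge> 3" for n
    using gap_cases[of n] gap_unique[of n] gap_unique[of "n + e + 2"] L[of n] S[of n] right[of n] that
    unfolding add.assoc[symmetric] by linarith
  then show thesis using that[of "e + 2"] by simp
next
  case True
  \<comment> \<open>A single left-drifting medium gap rules out all right-drifting ones.\<close>
  then have left: "long (n + e + 1) \<and> medium (n + e)" if "medium n" "n \<ge> 2" for n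
    using medium_drift[OF that] that not_both_drifts by blast
  have S: "short (n + e)" if "short n" "n \<ge> 2" for n
  proof (rule ccontr)
    assume "\<not> short (n + e)"
    then have m: "medium (n + e)"
      using gap_cases not_long_after_short[OF that(1)] by blast
    then have "v (n + e + e + 1) = v n"
      using that by (simp add: medium_def short_def)
    then show False
      using left[OF m] not_short_and_long that by (metis trans_le_add1)
  qed
  have L: "long (n + e)" if "long n" "n \<ge> 2" for n
    using S[of "Suc n"] that by (simp add: long_iff_short_Suc)
  have "(short (n + e) \<longleftrightarrow> short n) \<and> (medium (n + e) \<longleftrightarrow> medium n) \<and>
      (long (n + e) \<longleftrightarrow> long n)" if "n \<ge> 3" for n
    using gap_cases[of n] gap_unique[of n] gap_unique[of "n + e"] L[of n] S[of n] left[of n] that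
    by linarith
  then show thesis using that[of e] e_ge by simp
qed

text \<open>Position \<open>n + e + 2\<close> ends a long gap from \<open>n\<close>, a medium one
  from \<open>n + 1\<close> or a short one from \<open>n + 2\<close>; by
  \<open>long_iff_short_Suc\<close> the type at \<open>n + 1\<close> decides which. Thus
  \<open>v\<close> obeys a recursion driven by the gaps.\<close>

lemma previous_occurrence:
  "v (Suc n + e + 1) = (if short (Suc n) then v n else if medium (Suc n) then v (Suc n) else v (n + 2))"
proof -
  have "short (n + 2)" if "\<not> short (Suc n)" "\<not> medium (Suc n)"
    using that gap_cases[of "Suc n"] long_iff_short_Suc[of "Suc n"] by simp
  then show ?thesis
    using long_iff_short_Suc[of n] by (auto simp: short_def medium_def long_def algebra_simps)
qed

lemma contradiction: False
proof -
  obtain D where D: "D > 0" "\<And>n. n \<ge> 3 \<Longrightarrow>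
      (short (n + D) \<longleftrightarrow> short n) \<and> (medium (n + D) \<longleftrightarrow> medium n) \<and> (long (n + D) \<longleftrightarrow> long n)"
    using gaps_periodic by metis
  have Dk: "(short (n + k * D) \<longleftrightarrow> short n) \<and> (medium (n + k * D) \<longleftrightarrow> medium n)" if "n \<ge> 3" for n k
  proof (induction k)
    case (Suc k)
    then show ?case using D(2)[of "n + k * D"] that by (simp add: algebra_simps)
  qed simp
  \<comment> \<open>By pigeonhole two of these windows agree. Their starts differ by a multiple of
    \<open>D\<close>, hence see the same gaps, and \<open>e + 2\<close> letters suffice to run the
    recursion of \<open>previous_occurrence\<close>.\<close>
  define f where "f k = v [3 + k * D \<rightarrow> 3 + k * D + (e + 2)]" for k
  have "finite A" using card_A card.infinite by fastforce
  moreover have "range f \<subseteq> {xs. set xs \<subseteq> A \<and> length xs = e + 2}"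
    using range_v by (auto simp: f_def subsequence_def image_subset_iff)
  ultimately have "finite (range f)"
    using finite_lists_length_eq finite_subset by blast
  then have "\<not> inj f" using finite_imageD infinite_UNIV_nat by blast
  then obtain k l where kl: "k < l" "f k = f l"
    by (metis injI linorder_neqE_nat)
  define s where "s = 3 + k * D"
  define p where "p = (l - k) * D"
  have p: "p > 0" using kl D(1) by (simp add: p_def)
  have sp: "s + p = 3 + l * D"
    using kl by (simp add: s_def p_def diff_mult_distrib mult_le_mono1)
  have per: "v (s + p + i) = v (s + i)" for i
  proof (induction i rule: less_induct)
    case (less i)
    show ?case
    proof (cases "i < e + 2")
      case True
      then have "f k ! i = v (s + i)" "f l ! i = v (s + p + i)"
        unfolding sp by (simp_all add: f_def s_def)
      then show ?thesis using kl(2) by simp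
    next
      case False
      then obtain j where i: "i = j + (e + 2)" by (metis le_add_diff_inverse2 not_less)
      have IH: "v (s + p + j) = v (s + j)" "v (s + p + Suc j) = v (s + Suc j)" "v (s + p + (j + 2)) = v (s + (j + 2))"
        using less e_ge by (simp_all add: i del: add_Suc_right)
      have "s \<ge> 3" by (simp add: s_def)
      then have "(short (Suc (s + p + j)) \<longleftrightarrow> short (Suc (s + j))) \<and>
          (medium (Suc (s + p + j)) \<longleftrightarrow> medium (Suc (s + j)))"
        using Dk[of "Suc (s + j)" "l - k"] by (simp add: p_def ac_simps)
      then show ?thesis
        using IH previous_occurrence[of "s + p + j"] previous_occurrence[of "s + j"]
        by (simp add: i ac_simps)
    qed
  qed
  \<comment> \<open>The period persists forever, so \<open>q = p\<close>, a square, is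
    available.\<close>
  have "p * (e - 1) < p"
    using p per by (intro low_rep[where i = s])
  then show False using e_ge by simp
qed

end

theorem theorem3:
  fixes d :: nat and A :: "'a set"
  assumes "d \<ge> 11" and "card A = d"
  shows "\<not> (\<exists>v :: 'a word. range v \<subseteq> A \<and> balanced A v \<and>
           critical_exponent v < ereal ((real d - 1) / (real d - 2)))"
proof
  assume "\<exists>v :: 'a word. range v \<subseteq> A \<and> balanced A v \<and>
           critical_exponent v < ereal ((real d - 1) / (real d - 2))"
  then obtain v :: "'a word" where v: "range v \<subseteq> A" "balanced A v"
      "critical_exponent v < ereal ((real d - 1) / (real d - 2))" by blast
  interpret balanced_low_repetition A v "d - 1"
  proof
    fix p q i assume p: "p > 0" and rep: "\<And>k. k < q \<Longrightarrow> v (i + p + k) = v (i + k)"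
    have "ereal (real (p + q) / real p) \<le> critical_exponent v"
      using critical_exponent_ge_repetition p rep by blast
    then have "ereal (real (p + q) / real p) < ereal ((real d - 1) / (real d - 2))"
      using v(3) by (rule le_less_trans)
    \<comment> \<open>Clearing denominators turns the bound on \<open>1 + q / p\<close> by
      \<open>1 + 1 / (d - 2)\<close> into the integer form required by the locale.\<close>
    then have "(real p + real q) * (real d - 2) < real p * (real d - 1)"
      using p assms(1) by (simp add: divide_simps mult.commute)
    then have "real q * (real d - 2) < real p" by (simp add: algebra_simps)
    then have "real (q * (d - 1 - 1)) < real p"
      using assms(1) by (simp add: of_nat_diff)
    then show "q * (d - 1 - 1) < p" by linarith
  qed (use assms v in auto)
  show False by (rule contradiction)
qed

end
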